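(* Let $G/\pi$ be a quotient graph with time-evolution matrix $\widetilde U=\widetilde S(2\widetilde Q\widetilde Q^\top-I)$, where $\widetilde S^2=I$, and discriminant $\widetilde D=\widetilde Q^\top\widetilde S\widetilde Q$. Define the time-dependent discriminant for $k\in\mathbb N\cup\{0\}$ as $\widetilde D_k=\widetilde Q^\top\widetilde U^k\widetilde Q$. Then $\widetilde D_k=T_k(\widetilde D)$ for all $k\in\mathbb N\cup\{0\}$, where $T_k$ is the Chebyshev polynomial of the first kind.
   Context: $G$ is a $d$-regular directed graph (all in- and out-degrees equal $d$) with an equitable vertex partition $\pi=\{C_1,\dots,C_r\}$ (every vertex of $C_i$ has the same number $b_{ij}$ of out-neighbours in $C_j$). $G/\pi$ is the directed multigraph on the cells with adjacency matrix $\widetilde A=(b_{ij})$, assumed $d$-regular, with shunt decomposition $\widetilde A=\sum_{j=1}^d\widetilde P_j$ into permutation matrices. The shift matrix is $\widetilde S=\sum_jE_{jj}\otimes\widetilde P_j$ ($E_{jj}$ the $d\times d$ diagonal matrix units), acting on $\mathbb C^{dr}$ with coordinates indexed by the arcs of $G/\pi$. $\widetilde Q\in\mathbb R^{dr\times r}$ is the normalized characteristic matrix of the partition of the arcs of $G/\pi$ by terminal vertex (each column is the indicator vector of a class divided by the square root of its size), so $\widetilde Q^\top\widetilde Q=I_r$. Chebyshev polynomials: $T_0(p)=1$, $T_1(p)=p$, $T_k(p)=2pT_{k-1}(p)-T_{k-2}(p)$. *)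

theory Defs
  imports
    "HOL-Analysis.Analysis"
    "HOL-Computational_Algebra.Polynomial"
    "Graph_Theory.Digraph"
begin

definition regular_digraph :: "('v, 'e) pre_digraph \<Rightarrow> nat \<Rightarrow> bool" where
  "regular_digraph G d \<longleftrightarrow> (\<forall>v\<in>verts G. out_degree G v = d \<and> in_degree G v = d)"

text \<open>The cells are indexed by a finite type, so the number \<open>r\<close> of cells is \<open>CARD('r)\<close>.\<close>

definition equitable_partition ::
  "('v, 'e) pre_digraph \<Rightarrow> ('r::finite \<Rightarrow> 'v set) \<Rightarrow> ('r \<Rightarrow> 'r \<Rightarrow> nat) \<Rightarrow> bool" where
  "equitable_partition G C b \<longleftrightarrow>
     (\<Union>i. C i) = verts G \<and> (\<forall>i. C i \<noteq> {}) \<and> (\<forall>i j. i \<noteq> j \<longrightarrow> C i \<inter> C j = {}) \<and>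
     (\<forall>i j. \<forall>x\<in>C i. card {y \<in> C j. x \<rightarrow>\<^bsub>G\<^esub> y} = b i j)"

definition multigraph_with_adjacency :: "('r, 'e) pre_digraph \<Rightarrow> ('r \<Rightarrow> 'r \<Rightarrow> nat) \<Rightarrow> bool" where
  "multigraph_with_adjacency H b \<longleftrightarrow>
     fin_digraph H \<and> verts H = UNIV \<and>
     (\<forall>i j. card {e \<in> arcs H. tail H e = i \<and> head H e = j} = b i j)"

definition permutation_matrix :: "real^'r^'r \<Rightarrow> bool" where
  "permutation_matrix A \<longleftrightarrow> (\<exists>p. bij p \<and> A = (\<chi> i j. if j = p i then 1 else 0))"

definition shunt_decomposition :: "real^'r^'r \<Rightarrow> ('d::finite \<Rightarrow> real^'r^'r) \<Rightarrow> bool" where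
  "shunt_decomposition A P \<longleftrightarrow> (\<forall>j. permutation_matrix (P j)) \<and> A = (\<Sum>j\<in>UNIV. P j)"

text \<open>
  The \<open>dr\<close> coordinates are the pairs in \<open>'d \<times> 'r\<close>, and they are themselves taken as the arcs of the
  multigraph: the pairs with first component \<open>j\<close> are the arcs of the \<open>j\<close>-th shunt.
  Since each shunt has exactly one arc entering and one arc leaving a given vertex, the
  second component may name either the terminal or the initial vertex of the arc;
  both conventions are admitted.
\<close>

definition arcs_indexed_by_shunts ::
  "('r, 'd \<times> 'r) pre_digraph \<Rightarrow> ('d \<Rightarrow> real^'r^'r) \<Rightarrow> bool" where
  "arcs_indexed_by_shunts H P \<longleftrightarrow>
     arcs H = UNIV \<and>
     (\<forall>e. P (fst e) $ tail H e $ head H e = 1) \<and>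
     ((\<forall>e. head H e = snd e) \<or> (\<forall>e. tail H e = snd e))"

definition kronecker :: "real^'n^'m \<Rightarrow> real^'q^'p \<Rightarrow> real^('n \<times> 'q)^('m \<times> 'p)" where
  "kronecker A B = (\<chi> x y. A $ fst x $ fst y * B $ snd x $ snd y)"

definition diagonal_unit :: "'d \<Rightarrow> real^'d^'d" where
  "diagonal_unit j = (\<chi> a c. if a = j \<and> c = j then 1 else 0)"

definition shift_matrix ::
  "('d::finite \<Rightarrow> real^'r^'r) \<Rightarrow> real^('d \<times> 'r)^('d \<times> 'r)" where
  "shift_matrix P = (\<Sum>j\<in>UNIV. kronecker (diagonal_unit j) (P j))"

text \<open>The partition of \<open>'a\<close> is given by the fibres of \<open>f\<close>; its cells index the columns.\<close>

definition normalized_characteristic_matrix :: "('a::finite \<Rightarrow> 'c) \<Rightarrow> real^'c^'a" where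
  "normalized_characteristic_matrix f =
     (\<chi> a c. if f a = c then 1 / sqrt (real (card {a'. f a' = c})) else 0)"

text \<open>The multiplication of the type \<open>real^'n^'n\<close> is componentwise, so the library's
  power operator is not the matrix power.\<close>

primrec matrix_pow :: "real^'n^'n \<Rightarrow> nat \<Rightarrow> real^'n^'n" where
  "matrix_pow A 0 = mat 1"
| "matrix_pow A (Suc k) = A ** matrix_pow A k"

definition poly_matrix :: "real poly \<Rightarrow> real^'n^'n \<Rightarrow> real^'n^'n" where
  "poly_matrix p A = (\<Sum>i\<le>degree p. coeff p i *\<^sub>R matrix_pow A i)"

fun chebyshev_T :: "nat \<Rightarrow> real poly" where
  "chebyshev_T 0 = 1"
| "chebyshev_T (Suc 0) = [:0, 1:]"
| "chebyshev_T (Suc (Suc k)) = 2 * [:0, 1:] * chebyshev_T (Suc k) - chebyshev_T k"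

end

theory Submission
  imports Defs
begin

text \<open>
  The reflection fixes the columns of \<open>Q\<close>, because \<open>Q\<close> has orthonormal columns, and \<open>S\<close> is
  an involution. Hence \<open>U Q = S Q\<close> and \<open>U\<^sup>2 Q = 2 U Q D - Q\<close>. Multiplying by \<open>Q\<^sup>\<top> U\<^sup>k\<close> from the
  left gives the Chebyshev recurrence for the time-dependent discriminant.
\<close>

lemma matrix_diff_ldistrib: "A ** (B - C) = A ** B - A ** (C :: real^'n^'m)"
  by (vector matrix_matrix_mult_def sum_subtractf[symmetric] field_simps)

lemma matrix_diff_rdistrib: "(A - B) ** C = A ** C - B ** (C :: real^'n^'m)"
  by (vector matrix_matrix_mult_def sum_subtractf[symmetric] field_simps)

lemma matrix_mult_scaleR_left: "(c *\<^sub>R A) ** B = c *\<^sub>R (A ** (B :: real^'n^'m))"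
  by (simp add: scalar_matrix_assoc)

lemma matrix_mult_scaleR_right: "A ** (c *\<^sub>R B) = c *\<^sub>R (A ** (B :: real^'n^'m))"
  by (simp add: matrix_scalar_ac scalar_matrix_assoc)

lemma matrix_mult_sum_right: "A ** (\<Sum>i\<in>I. B i) = (\<Sum>i\<in>I. A ** (B i :: real^'n^'m))"
  by (induction I rule: infinite_finite_induct) (simp_all add: matrix_add_ldistrib)

lemma matrix_pow_commute: "matrix_pow A n ** A = A ** matrix_pow A n"
  by (induction n) (simp_all add: matrix_mul_assoc[symmetric])

text \<open>Coefficients above the degree vanish, so polynomials of different degrees can be
  evaluated over one common range and compared term by term.\<close>

lemma poly_matrix_altdef:
  assumes "degree p \<le> n"
  shows "poly_matrix p A = (\<Sum>i\<le>n. coeff p i *\<^sub>R matrix_pow A i)"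
  unfolding poly_matrix_def
  by (rule sum.mono_neutral_left) (use assms in \<open>auto simp: coeff_eq_0\<close>)

lemma poly_matrix_diff: "poly_matrix (p - q) A = poly_matrix p A - poly_matrix q A"
proof -
  define n where "n = max (degree p) (degree q)"
  have "degree (p - q) \<le> n" "degree p \<le> n" "degree q \<le> n"
    by (auto simp: n_def degree_diff_le)
  then show ?thesis
    by (simp add: poly_matrix_altdef[of _ n] scaleR_diff_left sum_subtractf)
qed

lemma poly_matrix_smult: "poly_matrix (smult c p) A = c *\<^sub>R poly_matrix p A"
  by (simp add: poly_matrix_altdef[of _ "degree p"] degree_smult_le scaleR_sum_right)

lemma poly_matrix_pCons_0: "poly_matrix (pCons 0 p) A = A ** poly_matrix p A"
  by (simp add: poly_matrix_altdef[OF degree_pCons_le] sum.atMost_Suc_shift poly_matrix_def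
      matrix_mult_sum_right matrix_mult_scaleR_right del: sum.atMost_Suc)

lemma poly_matrix_1 [simp]: "poly_matrix 1 A = mat 1"
  by (simp add: poly_matrix_def)

lemma poly_matrix_X [simp]: "poly_matrix [:0, 1:] A = A"
  by (simp only: poly_matrix_pCons_0 one_pCons[symmetric] poly_matrix_1 matrix_mul_rid)

text \<open>Reconciles two recurrences: the walk produces the factor \<open>D\<close> on the right,
  the Chebyshev recurrence on the left.\<close>

lemma poly_matrix_commute: "poly_matrix p A ** A = A ** poly_matrix p A"
proof (induction p)
  case 0
  then show ?case by (simp add: poly_matrix_def)
next
  case (pCons a p)
  \<comment> \<open>The constant term is written as a subtracted multiple of \<open>1\<close>, so
    the rule for differences handles it.\<close>
  have "pCons a p = pCons 0 p - smult (- a) 1"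
    by (simp add: one_pCons)
  then have "poly_matrix (pCons a p) A = A ** poly_matrix p A - (- a) *\<^sub>R mat 1"
    by (simp only: poly_matrix_diff poly_matrix_smult poly_matrix_pCons_0 poly_matrix_1)
  then show ?case
    by (simp only: pCons matrix_diff_ldistrib matrix_diff_rdistrib matrix_mult_scaleR_left
        matrix_mult_scaleR_right matrix_mul_assoc[symmetric] matrix_mul_lid matrix_mul_rid)
qed

lemma poly_matrix_chebyshev_T_Suc_Suc:
  "poly_matrix (chebyshev_T (Suc (Suc k))) A =
     2 *\<^sub>R (A ** poly_matrix (chebyshev_T (Suc k)) A) - poly_matrix (chebyshev_T k) A"
proof -
  have "chebyshev_T (Suc (Suc k)) = smult 2 (pCons 0 (chebyshev_T (Suc k))) - chebyshev_T k"
    by (simp add: numeral_poly)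
  then show ?thesis
    by (simp only: poly_matrix_diff poly_matrix_smult poly_matrix_pCons_0)
qed

text \<open>Distinct columns have disjoint supports, and a fibre of size \<open>s\<close>
  contributes \<open>s\<close> squared entries \<open>1 / s\<close>. Surjectivity gives
  \<open>s > 0\<close>; an empty fibre would yield a zero column.\<close>

lemma normalized_characteristic_matrix_orthonormal:
  assumes "surj f"
  shows "transpose (normalized_characteristic_matrix f) ** normalized_characteristic_matrix f =
    (mat 1 :: real^'c::finite^'c)"
proof -
  have "(\<Sum>a\<in>UNIV. normalized_characteristic_matrix f $ a $ i *
      normalized_characteristic_matrix f $ a $ j) = (if i = j then 1 else (0::real))" for i j :: 'c
  proof -
    define s where "s = real (card {a. f a = i})"
    have "{a. f a = i} \<noteq> {}"
      using surjD[OF assms, of i] by auto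
    then have "s > 0"
      unfolding s_def of_nat_0_less_iff card_gt_0_iff by simp
    have "(\<Sum>a\<in>UNIV. normalized_characteristic_matrix f $ a $ i *
        normalized_characteristic_matrix f $ a $ j) =
        (\<Sum>a\<in>UNIV. if f a = i then if i = j then 1 / s else 0 else 0)"
      by (rule sum.cong) (auto simp: normalized_characteristic_matrix_def s_def)
    also have "\<dots> = (\<Sum>a | f a = i. if i = j then 1 / s else 0)"
      by (simp add: sum.If_cases)
    also have "\<dots> = (if i = j then 1 else 0)"
      using \<open>s > 0\<close> by (simp flip: s_def)
    finally show ?thesis .
  qed
  then show ?thesis
    by (simp add: vec_eq_iff matrix_matrix_mult_def transpose_def mat_def)
qed

lemma szegedy_walk_discriminant:
  fixes S U :: "real^'n^'n" and Q :: "real^'m^'n"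
  assumes Q: "transpose Q ** Q = mat 1" and S: "S ** S = mat 1"
    and U: "U = S ** (2 *\<^sub>R (Q ** transpose Q) - mat 1)"
    and D: "D = transpose Q ** S ** Q"
  shows "transpose Q ** matrix_pow U k ** Q = poly_matrix (chebyshev_T k) D"
proof -
  \<comment> \<open>The product is bracketed so that \<open>transpose Q ** X\<close> stands alone:
    it is the identity for \<open>X = Q\<close> and becomes \<open>D\<close> for
    \<open>X = S ** Q\<close>.\<close>
  have UX: "U ** X = 2 *\<^sub>R (S ** Q ** (transpose Q ** X)) - S ** X" for X :: "real^'m^'n"
    by (simp add: U matrix_diff_ldistrib matrix_diff_rdistrib matrix_mult_scaleR_left
        matrix_mult_scaleR_right matrix_mul_assoc)
  have UQ: "U ** Q = S ** Q"
    by (simp add: UX Q scaleR_2)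
  \<comment> \<open>Take \<open>X = S ** Q\<close> in \<open>UX\<close>; the subtracted term
    \<open>S ** (S ** Q)\<close> collapses to \<open>Q\<close> because \<open>S\<close> is an
    involution.\<close>
  have UUQ: "U ** (U ** Q) = 2 *\<^sub>R (U ** Q ** D) - Q"
    unfolding UQ unfolding UX D by (simp add: matrix_mul_assoc S)
  show ?thesis
  proof (induction k rule: chebyshev_T.induct)
    case 1
    then show ?case by (simp add: Q)
  next
    case 2
    then show ?case by (simp add: D matrix_mul_assoc[symmetric] UQ)
  next
    case (3 k)
    \<comment> \<open>\<open>matrix_pow\<close> adds factors on the left; commuting two of them to
      the right places them next to \<open>Q\<close>, where \<open>UUQ\<close> applies.\<close>
    have "transpose Q ** matrix_pow U (Suc (Suc k)) ** Q =
        transpose Q ** matrix_pow U k ** (U ** (U ** Q))"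
      by (simp add: matrix_mul_assoc matrix_pow_commute[symmetric])
    also have "\<dots> = 2 *\<^sub>R (transpose Q ** matrix_pow U (Suc k) ** Q ** D) -
        transpose Q ** matrix_pow U k ** Q"
      unfolding UUQ
      by (simp add: matrix_diff_ldistrib matrix_mult_scaleR_right matrix_mul_assoc
          matrix_pow_commute[symmetric])
    also have "\<dots> = poly_matrix (chebyshev_T (Suc (Suc k))) D"
      by (simp only: 3 poly_matrix_commute poly_matrix_chebyshev_T_Suc_Suc)
    finally show ?case .
  qed
qed

theorem lemma6p5:
  fixes G :: "('v, 'e) pre_digraph"
    and C :: "'r::finite \<Rightarrow> 'v set"
    and b :: "'r \<Rightarrow> 'r \<Rightarrow> nat"
    and H :: "('r, 'd::finite \<times> 'r) pre_digraph"
    and P :: "'d \<Rightarrow> real^'r^'r"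
    and S U :: "real^('d \<times> 'r)^('d \<times> 'r)"
    and Q :: "real^'r^('d \<times> 'r)"
    and D :: "real^'r^'r"
    and Dt :: "nat \<Rightarrow> real^'r^'r"
    and k :: nat
  assumes "fin_digraph G" and "nomulti_digraph G"
    and "regular_digraph G CARD('d)"
    and "equitable_partition G C b"
    and "multigraph_with_adjacency H b"
    and "regular_digraph H CARD('d)"
    and "shunt_decomposition (\<chi> i j. real (b i j)) P"
    and "arcs_indexed_by_shunts H P"
    and "S = shift_matrix P"
    and "Q = normalized_characteristic_matrix (head H)"
    and "U = S ** (2 *\<^sub>R (Q ** transpose Q) - mat 1)"
    and "S ** S = mat 1"
    and "D = transpose Q ** S ** Q"
    and "\<And>n. Dt n = transpose Q ** matrix_pow U n ** Q"
  shows "Dt k = poly_matrix (chebyshev_T k) D"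
proof -
  \<comment> \<open>Each vertex has in-degree \<open>CARD('d)\<close>, which is positive because
    types are nonempty. Hence no class of arcs with a given terminal vertex is empty.\<close>
  have "\<exists>e. head H e = v" for v
  proof -
    have "card (in_arcs H v) = CARD('d)"
      using assms(5,6) by (simp add: multigraph_with_adjacency_def regular_digraph_def in_degree_def)
    then have "in_arcs H v \<noteq> {}"
      by auto
    then show ?thesis
      by (auto simp: in_arcs_def)
  qed
  then have "surj (head H)"
    by (metis surjI)
  then have "transpose Q ** Q = mat 1"
    using assms(10) normalized_characteristic_matrix_orthonormal by blast
  then show ?thesis
    using szegedy_walk_discriminant assms(11-14) by metis
qed

end
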